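(* Let $(X,d)$ be a distance space and let $\pi\colon\mathsf{Cob}(X,d)\to X$ be the compression map. Then $|\pi(A)|\le\mathrm{dens}(A)$ for any $A\subset\mathsf{Cob}(X,d)$. Consequently, for any metric space $(X,d)$, the fibers of $\pi$ coincide with the separablewise components of $\mathsf{Cob}(X,d)$, which in turn coincide with the arcwise components of $\mathsf{Cob}(X,d)$.
   Context: A distance space is a pair $(X,d)$ where $d\colon X\times X\to[0,\infty)$ is any function with $d(x,x)=0$ for all $x\in X$ (no symmetry or triangle inequality is assumed); every metric space is a distance space. Complete oriented graph. For a set $X$ and distinct $x,y\in X$ the oriented edge is $[x,y]=\{x,y\}\cup\{(x,y,t): t\in(0,1)\}$, where the points $(x,y,t)$ are pairwise distinct for distinct triples and do not belong to $X$; thus $[x,y]\cap[y,x]=\{x,y\}$. Let $\Gamma(X)=X\cup\bigcup\{[x,y]: x,y\in X,\ x\ne y\}$. On pairs of points of a common edge define, for distinct $x,y\in X$ and $t,s\in(0,1)$: $r(x,x)=0$, $r(x,y)=1$, $r((x,y,t),(x,y,s))=|t-s|$, $r(x,(x,y,t))=r((x,y,t),x)=t$, $r(y,(x,y,t))=r((x,y,t),y)=1-t$. For $a,b\in\Gamma(X)$ let $\rho(a,b)$ be the infimum of $\sum_{i=1}^n r(a_i,a_{i-1})$ over all finite sequences $a=a_0,a_1,\dots,a_n=b$ in $\Gamma(X)$ such that any two consecutive points lie on a common edge (with $\rho(a,a)=0$). Then $\rho$ is a metric on $\Gamma(X)$ and each edge is isometric to $[0,1]$. Cobweb. Let $(X,d)$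 be a distance space and $d_1=\min\{d,1/2\}$. For distinct $a,b\in X$ let $a_b\in[a,b]$ be the unique point with $\rho(a_b,b)=d_1(b,a)$, and let $[a,a_b]=\{z\in[a,b]:\rho(a,z)\le 1-d_1(b,a)\}$. Let $Z_a=\{a\}\cup\bigcup\{[a,a_b]\setminus\{b\}: b\in X\setminus\{a\}\}$. The cobweb over $(X,d)$ is $\mathsf{Cob}(X,d)=\bigcup_{a\in X}Z_a\subset\Gamma(X)$ with the metric $\rho$ restricted from $\Gamma(X)$. The sets $Z_a$ are pairwise disjoint, and the compression map $\pi\colon\mathsf{Cob}(X,d)\to X$ is defined by $\pi(Z_a)=\{a\}$ for all $a\in X$. $\mathrm{dens}(A)=\min\{|D|: D\subset A\subset\overline D\}$ is the density of $A$. The separablewise component of a point $x_0$ of a topological space is the union of all separable connected subsets containing $x_0$. Arcwise components are the maximal arcwise connected subsets (any two distinct points joined by a homeomorphic image of $[0,1]$). *)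

theory Defs
  imports "HOL-Analysis.Analysis"
begin

unbundle cardinal_syntax

definition distance_space :: "'a set \<Rightarrow> ('a \<Rightarrow> 'a \<Rightarrow> real) \<Rightarrow> bool" where
  "distance_space X d \<longleftrightarrow> (\<forall>x\<in>X. \<forall>y\<in>X. 0 \<le> d x y) \<and> (\<forall>x\<in>X. d x x = 0)"


section \<open>The complete oriented graph\<close>

text \<open>\<open>Inner x y t\<close> is the point \<open>(x, y, t)\<close> of the oriented edge from \<open>x\<close> to \<open>y\<close>; it is meaningful
  only for \<open>x \<noteq> y\<close> and \<open>0 < t < 1\<close>.\<close>

datatype 'a graph_point = Vertex 'a | Inner 'a 'a real

definition oriented_edge :: "'a \<Rightarrow> 'a \<Rightarrow> 'a graph_point set" where
  "oriented_edge x y = {Vertex x, Vertex y} \<union> {Inner x y t | t. 0 < t \<and> t < 1}"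

definition complete_graph :: "'a set \<Rightarrow> 'a graph_point set" where
  "complete_graph X = Vertex ` X \<union> (\<Union>{oriented_edge x y | x y. x \<in> X \<and> y \<in> X \<and> x \<noteq> y})"

definition on_common_edge :: "'a set \<Rightarrow> 'a graph_point \<Rightarrow> 'a graph_point \<Rightarrow> bool" where
  "on_common_edge X p q \<longleftrightarrow>
     (\<exists>x\<in>X. \<exists>y\<in>X. x \<noteq> y \<and> p \<in> oriented_edge x y \<and> q \<in> oriented_edge x y)"

text \<open>The length \<open>r\<close> of a step inside one edge; only used for pairs on a common edge.\<close>

fun step_length :: "'a graph_point \<Rightarrow> 'a graph_point \<Rightarrow> real" where
  "step_length (Vertex x) (Vertex y) = (if x = y then 0 else 1)"
| "step_length (Vertex z) (Inner x y t) =
     (if z = x then t else if z = y then 1 - t else undefined)"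
| "step_length (Inner x y t) (Vertex z) =
     (if z = x then t else if z = y then 1 - t else undefined)"
| "step_length (Inner x y t) (Inner x' y' s) =
     (if x = x' \<and> y = y' then \<bar>t - s\<bar> else undefined)"

definition graph_chain ::
    "'a set \<Rightarrow> 'a graph_point \<Rightarrow> 'a graph_point \<Rightarrow> nat \<Rightarrow> (nat \<Rightarrow> 'a graph_point) \<Rightarrow> bool" where
  "graph_chain X a b n p \<longleftrightarrow>
     p 0 = a \<and> p n = b \<and> (\<forall>i\<le>n. p i \<in> complete_graph X) \<and>
     (\<forall>i\<in>{1..n}. on_common_edge X (p (i - 1)) (p i))"

definition chain_length :: "nat \<Rightarrow> (nat \<Rightarrow> 'a graph_point) \<Rightarrow> real" where
  "chain_length n p = (\<Sum>i=1..n. step_length (p i) (p (i - 1)))"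

text \<open>The metric \<open>\<rho>\<close>. The value \<open>0\<close> off \<open>complete_graph X\<close> is immaterial; it is needed because
  \<^const>\<open>Metric_space\<close> demands non-negativity on the whole type.\<close>

definition graph_dist :: "'a set \<Rightarrow> 'a graph_point \<Rightarrow> 'a graph_point \<Rightarrow> real" where
  "graph_dist X a b =
     (if a \<in> complete_graph X \<and> b \<in> complete_graph X \<and> a \<noteq> b
      then Inf {chain_length n p | n p. graph_chain X a b n p} else 0)"


section \<open>The cobweb\<close>

definition trunc_dist :: "('a \<Rightarrow> 'a \<Rightarrow> real) \<Rightarrow> 'a \<Rightarrow> 'a \<Rightarrow> real" where
  "trunc_dist d x y = min (d x y) (1 / 2)"

text \<open>\<open>cobweb_segment X d a b\<close> is \<open>[a, a\<^sub>b]\<close>, whose end point \<open>a\<^sub>b\<close> lies at distance \<open>d\<^sub>1(b, a)\<close>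
  from \<open>b\<close>.\<close>

definition cobweb_segment ::
    "'a set \<Rightarrow> ('a \<Rightarrow> 'a \<Rightarrow> real) \<Rightarrow> 'a \<Rightarrow> 'a \<Rightarrow> 'a graph_point set" where
  "cobweb_segment X d a b =
     {z \<in> oriented_edge a b. graph_dist X (Vertex a) z \<le> 1 - trunc_dist d b a}"

definition cobweb_star :: "'a set \<Rightarrow> ('a \<Rightarrow> 'a \<Rightarrow> real) \<Rightarrow> 'a \<Rightarrow> 'a graph_point set" where
  "cobweb_star X d a = {Vertex a} \<union> (\<Union>b\<in>X - {a}. cobweb_segment X d a b - {Vertex b})"

definition cobweb :: "'a set \<Rightarrow> ('a \<Rightarrow> 'a \<Rightarrow> real) \<Rightarrow> 'a graph_point set" where
  "cobweb X d = (\<Union>a\<in>X. cobweb_star X d a)"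

definition cobweb_topology :: "'a set \<Rightarrow> ('a \<Rightarrow> 'a \<Rightarrow> real) \<Rightarrow> 'a graph_point topology" where
  "cobweb_topology X d = Metric_space.mtopology (cobweb X d) (graph_dist X)"

definition compression :: "'a set \<Rightarrow> ('a \<Rightarrow> 'a \<Rightarrow> real) \<Rightarrow> 'a graph_point \<Rightarrow> 'a" where
  "compression X d p = (THE a. a \<in> X \<and> p \<in> cobweb_star X d a)"

definition compression_fibers ::
    "'a set \<Rightarrow> ('a \<Rightarrow> 'a \<Rightarrow> real) \<Rightarrow> 'a graph_point set set" where
  "compression_fibers X d = (\<lambda>x. {p \<in> cobweb X d. compression X d p = x}) ` X"


section \<open>Density and components\<close>

text \<open>The least cardinal, as a cardinal order, of a dense subset of the subspace \<open>A\<close>.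
  It is determined up to \<open>=o\<close>.\<close>

definition top_density :: "'a topology \<Rightarrow> 'a set \<Rightarrow> 'a rel" where
  "top_density T A =
     (let R = {|D| | D. D \<subseteq> A \<and> A \<subseteq> T closure_of D}
      in SOME r. r \<in> R \<and> (\<forall>r'\<in>R. r \<le>o r'))"

definition separablewise_component :: "'a topology \<Rightarrow> 'a \<Rightarrow> 'a set" where
  "separablewise_component T x =
     \<Union>{S. x \<in> S \<and> connectedin T S \<and> separable_space (subtopology T S)}"

definition arcwise_connectedin :: "'a topology \<Rightarrow> 'a set \<Rightarrow> bool" where
  "arcwise_connectedin T S \<longleftrightarrow>
     S \<subseteq> topspace T \<and>
     (\<forall>x\<in>S. \<forall>y\<in>S. x \<noteq> y \<longrightarrow>
        (\<exists>g. embedding_map (top_of_set {0..1::real}) T g \<and> g ` {0..1} \<subseteq> S \<and> g 0 = x \<and> g 1 = y))"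

text \<open>Non-emptiness only matters for the empty space, which has no components.\<close>

definition arcwise_components :: "'a topology \<Rightarrow> 'a set set" where
  "arcwise_components T =
     {S. S \<noteq> {} \<and> arcwise_connectedin T S \<and>
         (\<forall>S'. arcwise_connectedin T S' \<and> S \<subseteq> S' \<longrightarrow> S' = S)}"


section \<open>Well-definedness\<close>

lemma top_density_attained:
  assumes "A \<subseteq> topspace T"
  shows "\<exists>D. D \<subseteq> A \<and> A \<subseteq> T closure_of D \<and> top_density T A = |D| \<and>
           (\<forall>D'. D' \<subseteq> A \<and> A \<subseteq> T closure_of D' \<longrightarrow> |D| \<le>o |D'| )"
proof -
  define R where "R = {|D| | D. D \<subseteq> A \<and> A \<subseteq> T closure_of D}"
  have "|A| \<in> R"
    using closure_of_subset[OF assms] unfolding R_def by blast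
  moreover have "\<forall>r\<in>R. Card_order r"
    by (auto simp: R_def card_of_Card_order)
  ultimately have "\<exists>r. r \<in> R \<and> (\<forall>r'\<in>R. r \<le>o r')"
    using exists_minim_Card_order[of R] by blast
  then have "top_density T A \<in> R \<and> (\<forall>r'\<in>R. top_density T A \<le>o r')"
    unfolding top_density_def Let_def R_def[symmetric] by (rule someI_ex)
  then obtain D where D: "D \<subseteq> A" "A \<subseteq> T closure_of D" "top_density T A = |D|"
    and min: "\<forall>r'\<in>R. top_density T A \<le>o r'"
    unfolding R_def by blast
  have "|D| \<le>o |D'|" if "D' \<subseteq> A" "A \<subseteq> T closure_of D'" for D'
  proof -
    have "|D'| \<in> R" using that unfolding R_def by blast
    then show ?thesis using min D(3) by metis
  qed
  with D show ?thesis by blast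
qed

lemma cobweb_star_origin:
  "p \<in> cobweb_star X d a \<Longrightarrow> a = (case p of Vertex x \<Rightarrow> x | Inner x y t \<Rightarrow> x)"
  by (auto simp: cobweb_star_def cobweb_segment_def oriented_edge_def)

lemma compression_eq:
  assumes "a \<in> X" "p \<in> cobweb_star X d a"
  shows "compression X d p = a"
  unfolding compression_def
  by (rule the_equality) (use assms in \<open>auto dest!: cobweb_star_origin split: graph_point.splits\<close>)

lemma cobweb_subset: "cobweb X d \<subseteq> complete_graph X"
proof
  fix p assume "p \<in> cobweb X d"
  then consider a where "a \<in> X" "p = Vertex a"
    | a b where "a \<in> X" "b \<in> X" "a \<noteq> b" "p \<in> oriented_edge a b"
    by (auto simp: cobweb_def cobweb_star_def cobweb_segment_def)
  then show "p \<in> complete_graph X"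
    by cases (auto simp: complete_graph_def)
qed

lemma on_common_edge_sym: "on_common_edge X p q \<Longrightarrow> on_common_edge X q p"
  unfolding on_common_edge_def by blast

lemma step_length_sym: "step_length p q = step_length q p"
  by (cases p; cases q) (auto simp: abs_minus_commute)

lemma step_length_nonneg: "on_common_edge X p q \<Longrightarrow> 0 \<le> step_length p q"
  by (auto simp: on_common_edge_def oriented_edge_def)

lemma chain_length_nonneg:
  assumes "graph_chain X a b n p"
  shows "0 \<le> chain_length n p"
  unfolding chain_length_def
proof (rule sum_nonneg)
  fix i assume "i \<in> {1..n}"
  then have "on_common_edge X (p (i - 1)) (p i)" using assms by (simp add: graph_chain_def)
  then show "0 \<le> step_length (p i) (p (i - 1))"
    by (rule step_length_nonneg[OF on_common_edge_sym])
qed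

lemma graph_chain_rev:
  assumes "graph_chain X a b n p"
  shows "graph_chain X b a n (\<lambda>i. p (n - i))" "chain_length n (\<lambda>i. p (n - i)) = chain_length n p"
proof -
  have "on_common_edge X (p (n - (i - 1))) (p (n - i))" if "i \<in> {1..n}" for i
  proof -
    have "n - (i - 1) \<in> {1..n}" "n - (i - 1) - 1 = n - i" using that by auto
    then show ?thesis
      using assms on_common_edge_sym unfolding graph_chain_def by metis
  qed
  then show "graph_chain X b a n (\<lambda>i. p (n - i))"
    using assms by (auto simp: graph_chain_def)
  show "chain_length n (\<lambda>i. p (n - i)) = chain_length n p"
    unfolding chain_length_def
  proof (rule sum.reindex_bij_witness[of _ "\<lambda>i. n + 1 - i" "\<lambda>i. n + 1 - i"])
    fix i assume "i \<in> {1..n}"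
    then have "n + 1 - i - 1 = n - i" "n - (i - 1) = n + 1 - i" by auto
    then show "step_length (p (n + 1 - i)) (p (n + 1 - i - 1)) =
        step_length (p (n - i)) (p (n - (i - 1)))"
      by (simp add: step_length_sym)
  qed auto
qed

lemma graph_chain_append:
  assumes p: "graph_chain X a b n p" and q: "graph_chain X b c m q"
  defines "s \<equiv> \<lambda>i. if i \<le> n then p i else q (i - n)"
  shows "graph_chain X a c (n + m) s" "chain_length (n + m) s = chain_length n p + chain_length m q"
proof -
  have s: "s (n + i) = q i" for i
    using p q by (auto simp: s_def graph_chain_def)
  have s_le: "s i = p i" if "i \<le> n" for i
    using that by (simp add: s_def)
  have split: "(\<exists>j\<in>{1..m}. i = n + j)" if "i \<in> {1..n + m}" "\<not> i \<le> n" for i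
    using that by (intro bexI[of _ "i - n"]) auto
  have edge: "on_common_edge X (s (i - 1)) (s i)" if i: "i \<in> {1..n + m}" for i
  proof (cases "i \<le> n")
    case True
    then show ?thesis using p i by (simp add: s_le graph_chain_def)
  next
    case False
    then obtain j where j: "j \<in> {1..m}" "i = n + j" using split i by blast
    then have "i - 1 = n + (j - 1)" by auto
    then have "s (i - 1) = q (j - 1)" "s i = q j" using j s by metis+
    then show ?thesis using q j by (simp add: graph_chain_def)
  qed
  have mem: "s i \<in> complete_graph X" if i: "i \<le> n + m" for i
    using p q i by (cases "i \<le> n") (auto simp: s_def graph_chain_def)
  show "graph_chain X a c (n + m) s"
    using edge mem p q s[of m] s_le[of 0] by (auto simp: graph_chain_def)
  have U: "{1..n + m} = {1..n} \<union> {n + 1..n + m}" by auto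
  have "chain_length (n + m) s =
      (\<Sum>i=1..n. step_length (s i) (s (i - 1))) + (\<Sum>i=n+1..n+m. step_length (s i) (s (i - 1)))"
    unfolding chain_length_def U by (rule sum.union_disjoint) auto
  also have "(\<Sum>i=1..n. step_length (s i) (s (i - 1))) = chain_length n p"
    unfolding chain_length_def by (rule sum.cong) (auto simp: s_le)
  also have "(\<Sum>i=n+1..n+m. step_length (s i) (s (i - 1))) = chain_length m q"
    unfolding chain_length_def
  proof (rule sum.reindex_bij_witness[of _ "\<lambda>i. n + i" "\<lambda>i. i - n"])
    fix i assume "i \<in> {n + 1..n + m}"
    then have "i = n + (i - n)" "i - 1 = n + (i - n - 1)" by auto
    then show "step_length (q (i - n)) (q (i - n - 1)) = step_length (s i) (s (i - 1))"
      using s by metis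
  qed auto
  finally show "chain_length (n + m) s = chain_length n p + chain_length m q" .
qed

lemma graph_chain_single:
  "on_common_edge X a b \<Longrightarrow> a \<in> complete_graph X \<Longrightarrow> b \<in> complete_graph X \<Longrightarrow>
   graph_chain X a b 1 (\<lambda>i. if i = 0 then a else b)"
  by (auto simp: graph_chain_def)

lemma graph_chain_exists:
  assumes "a \<in> complete_graph X" "b \<in> complete_graph X"
  shows "\<exists>n p. graph_chain X a b n p"
proof -
  have refl: "graph_chain X c c 0 (\<lambda>_. c)" if "c \<in> complete_graph X" for c
    using that by (simp add: graph_chain_def)
  have to_vertex: "\<exists>x\<in>X. \<exists>n p. graph_chain X c (Vertex x) n p" if c: "c \<in> complete_graph X" for c
  proof -
    consider x where "x \<in> X" "c = Vertex x"
      | x y where "x \<in> X" "y \<in> X" "x \<noteq> y" "c \<in> oriented_edge x y"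
      using c by (auto simp: complete_graph_def)
    then show ?thesis
    proof cases
      case 1
      then show ?thesis using refl c by blast
    next
      case 2
      then have "on_common_edge X c (Vertex x)"
        by (auto simp: on_common_edge_def oriented_edge_def)
      moreover have "Vertex x \<in> complete_graph X" using 2 by (auto simp: complete_graph_def)
      ultimately show ?thesis using graph_chain_single c 2(1) by blast
    qed
  qed
  obtain x n p where x: "x \<in> X" "graph_chain X a (Vertex x) n p" using to_vertex assms by blast
  obtain y m q where y: "y \<in> X" "graph_chain X b (Vertex y) m q" using to_vertex assms by blast
  have V: "Vertex x \<in> complete_graph X" "Vertex y \<in> complete_graph X"
    using x y by (auto simp: complete_graph_def)
  have "\<exists>k s. graph_chain X (Vertex x) (Vertex y) k s"
  proof (cases "x = y")
    case True
    then show ?thesis using refl V by blast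
  next
    case False
    then have "on_common_edge X (Vertex x) (Vertex y)"
      using x y by (auto simp: on_common_edge_def oriented_edge_def)
    then show ?thesis using graph_chain_single V by blast
  qed
  then show ?thesis
    using x(2) graph_chain_rev(1)[OF y(2)] graph_chain_append(1) by blast
qed

lemma graph_dist_le:
  assumes "graph_chain X a b n p"
  shows "graph_dist X a b \<le> chain_length n p"
proof (cases "a \<in> complete_graph X \<and> b \<in> complete_graph X \<and> a \<noteq> b")
  case True
  have "bdd_below {chain_length n p | n p. graph_chain X a b n p}"
    using chain_length_nonneg by (intro bdd_belowI[of _ 0]) auto
  then show ?thesis
    using True assms by (auto simp: graph_dist_def intro!: cInf_lower)
next
  case False
  have "graph_dist X a b = 0" using False by (auto simp: graph_dist_def)
  then show ?thesis using chain_length_nonneg[OF assms] by simp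
qed

lemma graph_dist_ge:
  assumes "a \<in> complete_graph X" "b \<in> complete_graph X" "a \<noteq> b"
    and "\<And>n p. graph_chain X a b n p \<Longrightarrow> l \<le> chain_length n p"
  shows "l \<le> graph_dist X a b"
  using assms graph_chain_exists[OF assms(1,2)]
  by (auto simp: graph_dist_def intro!: cInf_greatest)

lemma graph_dist_ge_Lipschitz:
  assumes "a \<in> complete_graph X" "b \<in> complete_graph X"
    and Lip: "\<And>p q. on_common_edge X p q \<Longrightarrow> \<bar>f p - f q\<bar> \<le> step_length p q"
  shows "\<bar>f a - f b\<bar> \<le> graph_dist X a b"
proof (cases "a = b")
  case True
  then show ?thesis by (simp add: graph_dist_def)
next
  case False
  show ?thesis
  proof (rule graph_dist_ge[OF assms(1,2) False])
    fix n p assume p: "graph_chain X a b n p"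
    have "\<bar>f (p 0) - f (p k)\<bar> \<le> chain_length k p" if "k \<le> n" for k
      using that
    proof (induction k)
      case 0
      then show ?case by (simp add: chain_length_def)
    next
      case (Suc k)
      have "on_common_edge X (p (Suc k)) (p k)"
        using p Suc.prems unfolding graph_chain_def
        by (metis Suc_eq_plus1 atLeastAtMost_iff diff_add_inverse2 le_add2 on_common_edge_sym)
      from Lip[OF this] Suc show ?case by (simp add: chain_length_def)
    qed
    from this[of n] show "\<bar>f a - f b\<bar> \<le> chain_length n p"
      using p by (simp add: graph_chain_def)
  qed
qed

text \<open>Two \<open>1\<close>-Lipschitz functions that separate the points of the graph.\<close>

fun vertex_height :: "'a \<Rightarrow> 'a graph_point \<Rightarrow> real" where
  "vertex_height v (Vertex w) = (if w = v then 0 else 1)"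
| "vertex_height v (Inner x y t) = (if x = v then t else if y = v then 1 - t else 1)"

fun edge_tent :: "'a \<Rightarrow> 'a \<Rightarrow> 'a graph_point \<Rightarrow> real" where
  "edge_tent x y (Vertex w) = 0"
| "edge_tent x y (Inner x' y' t) = (if x' = x \<and> y' = y then min t (1 - t) else 0)"

lemma vertex_height_Lipschitz:
  "on_common_edge X p q \<Longrightarrow> \<bar>vertex_height v p - vertex_height v q\<bar> \<le> step_length p q"
  by (auto simp: on_common_edge_def oriented_edge_def)

lemma edge_tent_Lipschitz:
  "on_common_edge X p q \<Longrightarrow> \<bar>edge_tent x y p - edge_tent x y q\<bar> \<le> step_length p q"
  by (auto simp: on_common_edge_def oriented_edge_def)

lemma graph_dist_edge:
  assumes "x \<in> X" "y \<in> X" "x \<noteq> y" "p \<in> oriented_edge x y" "q \<in> oriented_edge x y"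
  shows "graph_dist X p q = step_length p q"
proof (rule antisym)
  have e: "on_common_edge X p q" using assms by (auto simp: on_common_edge_def)
  have mem: "p \<in> complete_graph X" "q \<in> complete_graph X"
    using assms by (auto simp: complete_graph_def)
  show "graph_dist X p q \<le> step_length p q"
    using graph_dist_le[OF graph_chain_single[OF e mem]]
    by (simp add: chain_length_def step_length_sym)
  have "step_length p q = \<bar>vertex_height x p - vertex_height x q\<bar>"
    using assms(3-5) by (auto simp: oriented_edge_def)
  also have "\<dots> \<le> graph_dist X p q"
    by (rule graph_dist_ge_Lipschitz[OF mem vertex_height_Lipschitz])
  finally show "step_length p q \<le> graph_dist X p q" .
qed

lemma graph_dist_pos:
  assumes "a \<in> complete_graph X" "b \<in> complete_graph X" "a \<noteq> b"
  shows "0 < graph_dist X a b"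
proof -
  have inner: "0 < t \<and> t < 1 \<and> x \<noteq> y \<and> x \<in> X \<and> y \<in> X" if "Inner x y t \<in> complete_graph X" for x y t
    using that by (auto simp: complete_graph_def oriented_edge_def)
  have v: "\<bar>vertex_height v a - vertex_height v b\<bar> \<le> graph_dist X a b" for v
    by (rule graph_dist_ge_Lipschitz[OF assms(1,2) vertex_height_Lipschitz])
  have t: "\<bar>edge_tent x y a - edge_tent x y b\<bar> \<le> graph_dist X a b" for x y
    by (rule graph_dist_ge_Lipschitz[OF assms(1,2) edge_tent_Lipschitz])
  show ?thesis
  proof (cases a)
    case (Vertex x)
    with v[of x] assms inner show ?thesis by (cases b) (fastforce split: if_splits)+
  next
    case a: (Inner x y s)
    show ?thesis
    proof (cases b)
      case (Vertex z)
      with v[of z] a assms inner show ?thesis by (fastforce split: if_splits)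
    next
      case b: (Inner x' y' s')
      show ?thesis
      proof (cases "x = x' \<and> y = y'")
        case True
        then show ?thesis using v[of x] a b assms by auto
      next
        case False
        then show ?thesis using t[of x y] a b assms inner[of x y s] by auto
      qed
    qed
  qed
qed

lemma Metric_space_complete_graph: "Metric_space (complete_graph X) (graph_dist X)"
proof
  fix a b c
  show nonneg: "0 \<le> graph_dist X a b" for a b
    using graph_dist_pos[of a X b] by (cases "a \<in> complete_graph X \<and> b \<in> complete_graph X \<and> a \<noteq> b")
      (auto simp: graph_dist_def)
  have "{chain_length n p | n p. graph_chain X a b n p} \<subseteq> {chain_length n p | n p. graph_chain X b a n p}"
    for a b
    using graph_chain_rev[where X = X and a = a and b = b] by (smt (verit, best) Collect_mono)
  then have "{chain_length n p | n p. graph_chain X a b n p} = {chain_length n p | n p. graph_chain X b a n p}"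
    for a b by blast
  then show "graph_dist X a b = graph_dist X b a"
    unfolding graph_dist_def by (metis (no_types, lifting))
  show "graph_dist X a b = 0 \<longleftrightarrow> a = b" if "a \<in> complete_graph X" "b \<in> complete_graph X"
    using that graph_dist_pos[of a X b] by (auto simp: graph_dist_def)
  show "graph_dist X a c \<le> graph_dist X a b + graph_dist X b c"
    if "a \<in> complete_graph X" "b \<in> complete_graph X" "c \<in> complete_graph X"
  proof (cases "a = b \<or> b = c")
    case True
    then show ?thesis by (auto simp: graph_dist_def)
  next
    case False
    have "graph_dist X a c - chain_length n p \<le> chain_length m q"
      if "graph_chain X a b n p" "graph_chain X b c m q" for n p m q
      using graph_dist_le[OF graph_chain_append(1)[OF that]] graph_chain_append(2)[OF that] by simp
    then have "graph_dist X a c - chain_length n p \<le> graph_dist X b c"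
      if "graph_chain X a b n p" for n p
      using graph_dist_ge[of b X c] \<open>b \<in> _\<close> \<open>c \<in> _\<close> False that by blast
    then have "graph_dist X a c - graph_dist X b c \<le> graph_dist X a b"
      using graph_dist_ge[of a X b "graph_dist X a c - graph_dist X b c"] \<open>a \<in> _\<close> \<open>b \<in> _\<close> False
      by (smt (verit))
    then show ?thesis by simp
  qed
qed

lemma Metric_space_cobweb: "Metric_space (cobweb X d) (graph_dist X)"
  using Metric_space.subspace[OF Metric_space_complete_graph cobweb_subset] .

end

theory Submission
  imports Defs
begin

text \<open>
  Everything rests on comparing \<open>\<rho>\<close> with functions on the whole graph that are \<open>1\<close>-Lipschitz
  along each edge, for these are \<open>1\<close>-Lipschitz for \<open>\<rho>\<close>.  Two such functions suffice.

  The first is the height over a vertex \<open>x\<close>, that is, the distance to \<open>x\<close> cut off at \<open>1\<close>.  It is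
  below \<open>1\<close> at every point of the star of \<open>x\<close>, because the star omits the far ends of its edges,
  and it equals \<open>1\<close> at every point other than \<open>x\<close> and the inner points of the edges with end \<open>x\<close>.
  Hence, if a point of the star of \<open>x\<close> lies in the closure of \<open>D\<close>, then \<open>D\<close> contains \<open>x\<close> or an
  inner point of an edge with end \<open>x\<close> (\<open>compression_closure_subset\<close>).  Each point of \<open>D\<close> serves
  at most two vertices \<open>x\<close> in this way, so an infinite \<open>D\<close> that is dense in \<open>A\<close> bounds
  \<open>|\<pi>(A)|\<close>, while a finite dense subset of \<open>A\<close> is all of \<open>A\<close>.

  The second function shows that, for a metric \<open>d\<close>, the truncated distance from a vertex \<open>x\<close> to
  \<open>\<pi>(p)\<close> is \<open>1\<close>-Lipschitz in \<open>p\<close> (\<open>trunc_dist_compression_Lipschitz\<close>): the cuts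
  in the edges are exactly long enough for it to have a \<open>1\<close>-Lipschitz extension over the gaps.
  On a connected separable set \<open>S\<close> this continuous function takes only countably many values,
  since \<open>\<pi>(S)\<close> is countable by the first part, and a countable connected set of reals has at
  most one element.  Taking \<open>x\<close> in \<open>\<pi>(S)\<close> shows that \<open>S\<close> lies in a single fiber.

  Conversely, the fibers are the stars, and two points of a star are joined by the arc that runs
  through its centre or stays on one edge (\<open>cobweb_star_arc\<close>).  Arcs are connected and separable,
  so the stars are also the separablewise and the arcwise components.
\<close>

section \<open>Lipschitz maps and arcs in abstract topological spaces\<close>

text \<open>The interval is compact and a metric space is Hausdorff, so a continuous injection
  is closed and therefore an embedding.\<close>

lemma Lipschitz_injection_of_interval_imp_embedding:
  fixes g :: "real \<Rightarrow> 'b"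
  assumes "Metric_space M d" "g ` {0..1} \<subseteq> M" "inj_on g {0..1}"
    and Lip: "\<And>u v. u \<in> {0..1} \<Longrightarrow> v \<in> {0..1} \<Longrightarrow> d (g u) (g v) \<le> C * \<bar>u - v\<bar>"
  shows "embedding_map (top_of_set {0..1}) (Metric_space.mtopology M d) g"
proof -
  interpret Metric_space M d by fact
  have "Lipschitz_continuous_map (submetric euclidean_metric {0..1::real}) (metric (M, d)) g"
    using assms(2) Lip by (auto simp: Lipschitz_continuous_map_def dist_real_def intro!: exI[of _ C])
  then have cont: "continuous_map (top_of_set {0..1}) mtopology g"
    using Lipschitz_continuous_imp_continuous_map[of "submetric euclidean_metric {0..1::real}" "metric (M, d)" g]
    by (simp add: mtopology_of_submetric)
  moreover have "closed_map (top_of_set {0..1}) mtopology g"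
    by (rule continuous_imp_closed_map_gen[OF _ _ cont])
       (auto simp: compact_space_subtopology Hausdorff_imp_kc_space Hausdorff_space_mtopology)
  ultimately show ?thesis
    using assms(3) by (intro injective_closed_imp_embedding_map) auto
qed

lemma Lipschitz_imp_continuous_map_real:
  fixes f :: "'b \<Rightarrow> real"
  assumes "Metric_space M d"
    and "\<And>x y. x \<in> M \<Longrightarrow> y \<in> M \<Longrightarrow> \<bar>f x - f y\<bar> \<le> C * d x y"
  shows "continuous_map (Metric_space.mtopology M d) euclideanreal f"
proof -
  interpret Metric_space M d by fact
  have "Lipschitz_continuous_map (metric (M, d)) euclidean_metric f"
    using assms by (auto simp: Lipschitz_continuous_map_def dist_real_def)
  then show ?thesis
    using Lipschitz_continuous_imp_continuous_map[of "metric (M, d)" euclidean_metric f] by simp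
qed

lemma separable_space_top_of_set:
  "separable_space (top_of_set (S :: 'b::{metric_space,second_countable_topology} set))"
proof -
  obtain T where T: "countable T" "T \<subseteq> S" "S \<subseteq> closure T"
    by (rule separable)
  then have "top_of_set S closure_of T = S"
    by (simp add: closure_of_subtopology inf.absorb2 inf.absorb1)
  with T show ?thesis
    unfolding separable_space_def by auto
qed

text \<open>An arc from \<open>x\<close> to \<open>y\<close> is a separable connected set, being a continuous image of the interval.\<close>

lemma arcwise_connectedin_imp_subset_separablewise_component:
  assumes S: "arcwise_connectedin T S" and x: "x \<in> S"
  shows "S \<subseteq> separablewise_component T x"
proof
  fix y assume y: "y \<in> S"
  show "y \<in> separablewise_component T x"
  proof (cases "x = y")
    case True
    have "connectedin T {x}"
      using S x by (auto simp: arcwise_connectedin_def connectedin_sing)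
    moreover have "separable_space (subtopology T {x})"
      using S x closure_of_subset[of "{x}" T]
      by (auto simp: separable_space_def arcwise_connectedin_def closure_of_subtopology
          intro!: exI[of _ "{x}"])
    ultimately show ?thesis
      unfolding separablewise_component_def True by blast
  next
    case False
    then obtain g where g: "embedding_map (top_of_set {0..1::real}) T g" "g ` {0..1} \<subseteq> S"
        "g 0 = x" "g 1 = y"
      using S x y unfolding arcwise_connectedin_def by blast
    have cont: "continuous_map (top_of_set {0..1}) T g"
      using g(1) by (simp add: embedding_map_def homeomorphic_eq_everything_map continuous_map_in_subtopology)
    have "connectedin (top_of_set {0..1::real}) {0..1}"
      by (simp add: connectedin_subtopology)
    then have "connectedin T (g ` {0..1})"
      by (rule connectedin_continuous_map_image[OF cont])
    moreover have "separable_space (subtopology T (g ` {0..1}))"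
    proof (rule separable_space_continuous_map_image[OF separable_space_top_of_set[of "{0..1::real}"]])
      show "continuous_map (top_of_set {0..1}) (subtopology T (g ` {0..1})) g"
        by (intro continuous_map_into_subtopology cont) auto
      have "g ` {0..1} \<subseteq> topspace T"
        using g(2) S by (auto simp: arcwise_connectedin_def)
      then show "g ` topspace (top_of_set {0..1}) = topspace (subtopology T (g ` {0..1}))"
        by auto
    qed
    moreover have "x \<in> g ` {0..1}" "y \<in> g ` {0..1}"
      using g(3,4) by force+
    ultimately show ?thesis
      unfolding separablewise_component_def by blast
  qed
qed

section \<open>Density bounds the image of the compression map\<close>

lemma cobweb_star_eq:
  assumes "a \<in> X"
  shows "cobweb_star X d a =
    {Vertex a} \<union> {Inner a b t | b t. b \<in> X \<and> b \<noteq> a \<and> 0 < t \<and> t < 1 \<and> t \<le> 1 - trunc_dist d b a}"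
proof -
  have "graph_dist X (Vertex a) (Inner a b t) = t" if "b \<in> X" "b \<noteq> a" "0 < t" "t < 1" for b t
    using graph_dist_edge[of a X b "Vertex a" "Inner a b t"] that assms by (auto simp: oriented_edge_def)
  then show ?thesis
    by (auto simp: cobweb_star_def cobweb_segment_def oriented_edge_def)
qed

lemma compression_fiber:
  assumes "a \<in> X"
  shows "{p \<in> cobweb X d. compression X d p = a} = cobweb_star X d a"
  using assms by (auto simp: cobweb_def compression_eq)

text \<open>A vertex is assigned only itself, although it is an end of every edge at it: only the vertices
  at distance less than \<open>1\<close> matter, and these must be finitely many.\<close>

fun edge_ends :: "'a graph_point \<Rightarrow> 'a set" where
  "edge_ends (Vertex v) = {v}"
| "edge_ends (Inner x y t) = {x, y}"

lemma finite_edge_ends: "finite (edge_ends p)"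
  by (cases p) auto

text \<open>A point of the star of \<open>x\<close> has height below \<open>1\<close> over \<open>x\<close>, so points of \<open>D\<close> close to it
  also have; and a point of height below \<open>1\<close> over \<open>x\<close> is \<open>x\<close> or an inner point of an edge
  with end \<open>x\<close>.\<close>

lemma compression_closure_subset:
  assumes "D \<subseteq> cobweb X d" "A \<subseteq> cobweb_topology X d closure_of D"
  shows "compression X d ` A \<subseteq> (\<Union>p\<in>D. edge_ends p)"
proof
  interpret Metric_space "cobweb X d" "graph_dist X" by (rule Metric_space_cobweb)
  fix x assume "x \<in> compression X d ` A"
  then obtain p where "p \<in> A" and x: "x = compression X d p" by blast
  then have p: "p \<in> cobweb X d" "\<And>r. 0 < r \<Longrightarrow> \<exists>q\<in>D. graph_dist X p q < r"
    using assms(2) by (auto simp: cobweb_topology_def metric_closure_of)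
  then have "x \<in> X" "p \<in> cobweb_star X d x"
    unfolding x by (auto simp: cobweb_def compression_eq)
  then have lt: "vertex_height x p < 1" by (auto simp: cobweb_star_eq)
  then obtain q where q: "q \<in> D" "graph_dist X p q < 1 - vertex_height x p"
    using p(2)[of "1 - vertex_height x p"] by auto
  have "\<bar>vertex_height x p - vertex_height x q\<bar> \<le> graph_dist X p q"
    using p(1) q(1) assms(1) cobweb_subset
    by (intro graph_dist_ge_Lipschitz vertex_height_Lipschitz) blast+
  then have "vertex_height x q \<noteq> 1" using q(2) by linarith
  then have "x \<in> edge_ends q" by (cases q) (auto split: if_splits)
  then show "x \<in> (\<Union>p\<in>D. edge_ends p)" using q(1) by blast
qed

lemma card_compression_le_top_density:
  assumes A: "A \<subseteq> cobweb X d"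
  shows "|compression X d ` A| \<le>o top_density (cobweb_topology X d) A"
proof -
  interpret Metric_space "cobweb X d" "graph_dist X" by (rule Metric_space_cobweb)
  have top: "cobweb_topology X d = mtopology" by (simp add: cobweb_topology_def)
  obtain D where D: "D \<subseteq> A" "A \<subseteq> cobweb_topology X d closure_of D" "top_density (cobweb_topology X d) A = |D|"
    using top_density_attained[of A "cobweb_topology X d"] A unfolding top by auto
  have "|compression X d ` A| \<le>o |D|"
  proof (cases "finite D")
    case True
    then have "mtopology closure_of D = D"
      using D(1) A by (intro closure_of_closedin closedin_Hausdorff_finite Hausdorff_space_mtopology) auto
    then have "A = D" using D unfolding top by blast
    then show ?thesis by (simp add: card_of_image)
  next
    case False
    have "|\<Union>p\<in>D. edge_ends p| \<le>o |D|"
    proof (rule card_of_UNION_ordLeq_infinite[OF False])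
      show "\<forall>p\<in>D. |edge_ends p| \<le>o |D|"
        using False finite_edge_ends
        by (intro ballI ordLess_imp_ordLeq finite_ordLess_infinite card_of_Well_order)
           (simp_all add: Field_card_of)
    qed (rule card_of_refl[THEN ordIso_imp_ordLeq])
    moreover have "|compression X d ` A| \<le>o |\<Union>p\<in>D. edge_ends p|"
      using compression_closure_subset[OF _ D(2)] D(1) A by (intro card_of_mono1) blast
    ultimately show ?thesis using ordLeq_transitive by blast
  qed
  then show ?thesis using D(3) by simp
qed

section \<open>Separable connected sets lie in one star\<close>

text \<open>On the edge from \<open>x\<close> to \<open>y\<close> the value is the median of \<open>f x\<close> and \<open>f y \<plusminus> (1 - t)\<close>: going back
  from the end \<open>y\<close>, it moves from \<open>f y\<close> towards \<open>f x\<close> at unit speed and stays at \<open>f x\<close> once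
  it is reached.\<close>

fun median_extension :: "('a \<Rightarrow> real) \<Rightarrow> 'a graph_point \<Rightarrow> real" where
  "median_extension f (Vertex v) = f v"
| "median_extension f (Inner x y t) = max (f y - (1 - t)) (min (f x) (f y + (1 - t)))"

lemma median_extension_Lipschitz:
  assumes "\<And>x y. x \<in> X \<Longrightarrow> y \<in> X \<Longrightarrow> \<bar>f x - f y\<bar> \<le> 1" "on_common_edge X p q"
  shows "\<bar>median_extension f p - median_extension f q\<bar> \<le> step_length p q"
proof -
  obtain x y where xy: "x \<in> X" "y \<in> X" "x \<noteq> y" "p \<in> oriented_edge x y" "q \<in> oriented_edge x y"
    using assms(2) by (auto simp: on_common_edge_def)
  with assms(1)[of x y] show ?thesis
    by (auto simp: oriented_edge_def max_def min_def)
qed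

text \<open>The median extension of the truncated distance \<open>d\<^sub>1\<close> from \<open>x\<close> is constant on each star.
  A point at position \<open>t\<close> of the edge from \<open>a\<close> to \<open>b\<close> belongs to the star of \<open>a\<close> only if
  \<open>d\<^sub>1(b, a) \<le> 1 - t\<close>, and by the triangle inequality the values at the two ends differ by
  at most \<open>d\<^sub>1(b, a)\<close>; so at that point the extension still has its value at \<open>a\<close>.\<close>

lemma trunc_dist_compression_Lipschitz:
  assumes "Metric_space X d" "x \<in> X" "p \<in> cobweb X d" "q \<in> cobweb X d"
  shows "\<bar>trunc_dist d x (compression X d p) - trunc_dist d x (compression X d q)\<bar> \<le> graph_dist X p q"
proof -
  interpret Metric_space X d by fact
  have tri: "\<bar>trunc_dist d x a - trunc_dist d x b\<bar> \<le> trunc_dist d b a" if "a \<in> X" "b \<in> X" for a b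
    using triangle[OF \<open>x \<in> X\<close> that] triangle[OF \<open>x \<in> X\<close> that(2,1)] commute[of a b]
      nonneg[of b a] nonneg[of x a] nonneg[of x b]
    unfolding trunc_dist_def by linarith
  have ext: "median_extension (trunc_dist d x) r = trunc_dist d x (compression X d r)" if r: "r \<in> cobweb X d" for r
  proof -
    obtain a where a: "a \<in> X" "r \<in> cobweb_star X d a"
      using r by (auto simp: cobweb_def)
    then have "median_extension (trunc_dist d x) r = trunc_dist d x a"
      using tri[OF a(1)] by (fastforce simp: cobweb_star_eq max_def min_def)
    then show ?thesis using compression_eq[OF a] by simp
  qed
  have "\<bar>trunc_dist d x a - trunc_dist d x b\<bar> \<le> 1" for a b
    using nonneg[of x a] nonneg[of x b] unfolding trunc_dist_def by linarith
  then have "\<bar>median_extension (trunc_dist d x) p - median_extension (trunc_dist d x) q\<bar> \<le> graph_dist X p q"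
    using assms(3,4) cobweb_subset
    by (intro graph_dist_ge_Lipschitz median_extension_Lipschitz[where X = X]) blast+
  then show ?thesis using ext assms(3,4) by simp
qed

text \<open>If \<open>D\<close> is countable and dense in \<open>S\<close>, then \<open>\<pi>(S)\<close> is countable.  The truncated distance
  from \<open>\<pi>(p)\<close> to \<open>\<pi>\<close> thus maps the connected set \<open>S\<close> onto a countable connected set of reals,
  which can only be \<open>{0}\<close>.\<close>

lemma connected_separable_imp_compression_eq:
  assumes X: "Metric_space X d" and S: "connectedin (cobweb_topology X d) S"
    and sep: "separable_space (subtopology (cobweb_topology X d) S)"
    and pq: "p \<in> S" "q \<in> S"
  shows "compression X d p = compression X d q"
proof -
  interpret X: Metric_space X d by fact
  interpret C: Metric_space "cobweb X d" "graph_dist X" by (rule Metric_space_cobweb)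
  have sub: "S \<subseteq> cobweb X d"
    using connectedin_subset_topspace[OF S] by (simp add: cobweb_topology_def)
  then have mem: "compression X d r \<in> X" if "r \<in> S" for r
    using that by (auto simp: cobweb_def compression_eq)
  obtain D where D: "countable D" "D \<subseteq> S" "S \<subseteq> cobweb_topology X d closure_of D"
    using sep unfolding separable_space_def closure_of_subtopology
    by (metis C.topspace_mtopology cobweb_topology_def inf.absorb_iff2 inf_le2 sub topspace_subtopology_subset)
  define f where "f r = trunc_dist d (compression X d p) (compression X d r)" for r
  have "countable (\<Union>r\<in>D. edge_ends r)"
    using D(1) finite_edge_ends by (intro countable_UN) (auto intro: countable_finite)
  then have "countable (compression X d ` S)"
    using compression_closure_subset[OF _ D(3)] D(2) sub countable_subset by blast
  then have "countable (f ` S)"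
    using countable_image[of "compression X d ` S" "trunc_dist d (compression X d p)"]
    by (simp add: f_def image_image)
  moreover have "connected (f ` S)"
  proof -
    have "continuous_map (cobweb_topology X d) euclideanreal f"
      unfolding cobweb_topology_def f_def
      using trunc_dist_compression_Lipschitz[OF X mem[OF pq(1)]]
      by (intro Lipschitz_imp_continuous_map_real[OF Metric_space_cobweb, where C = 1]) auto
    from connectedin_continuous_map_image[OF this S] show ?thesis by simp
  qed
  ultimately have "f q = f p"
    using pq connected_uncountable by blast
  then show ?thesis
    using mem pq by (auto simp: f_def trunc_dist_def min_def split: if_splits)
qed


section \<open>Arcs in a star\<close>

definition spoke :: "'a \<Rightarrow> 'a \<Rightarrow> real \<Rightarrow> 'a graph_point" where
  "spoke a b u = (if u = 0 then Vertex a else Inner a b u)"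

text \<open>Negative parameters lie on the edge towards \<open>b\<close>, positive ones on the edge towards \<open>c\<close>,
  and \<open>0\<close> is the centre.  For \<open>b = c\<close> the non-negative half still parametrizes a single edge, so that
  one formula serves for all pairs of points of a star.\<close>

definition bent_path :: "'a \<Rightarrow> 'a \<Rightarrow> 'a \<Rightarrow> real \<Rightarrow> 'a graph_point" where
  "bent_path a b c u = (if u < 0 then spoke a b (- u) else spoke a c u)"

lemma graph_dist_spoke:
  assumes "a \<in> X" "b \<in> X" "a \<noteq> b" "0 \<le> u" "u < 1" "0 \<le> v" "v < 1"
  shows "graph_dist X (spoke a b u) (spoke a b v) = \<bar>u - v\<bar>"
proof -
  have "graph_dist X (spoke a b u) (spoke a b v) = step_length (spoke a b u) (spoke a b v)"
    using assms by (intro graph_dist_edge[of a X b]) (auto simp: spoke_def oriented_edge_def)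
  then show ?thesis using assms by (auto simp: spoke_def)
qed

text \<open>On one edge the distance is the difference of the parameters; across the centre it is estimated
  by the triangle inequality.  Equality can fail there: for \<open>b \<noteq> c\<close> and parameters that differ by
  more than \<open>3 / 2\<close>, the way round through \<open>b\<close> and \<open>c\<close> is shorter.\<close>

lemma bent_path_Lipschitz:
  assumes a: "a \<in> X" and b: "b \<in> X - {a}" and c: "c \<in> X - {a}" and uv: "\<bar>u\<bar> < 1" "\<bar>v\<bar> < 1"
  shows "graph_dist X (bent_path a b c u) (bent_path a b c v) \<le> \<bar>u - v\<bar>"
proof -
  interpret Metric_space "complete_graph X" "graph_dist X" by (rule Metric_space_complete_graph)
  have mem: "spoke a e w \<in> complete_graph X" if "e \<in> X - {a}" "0 \<le> w" "w < 1" for e w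
  proof -
    have "spoke a e w \<in> oriented_edge a e"
      using that by (auto simp: spoke_def oriented_edge_def)
    then show ?thesis using a that unfolding complete_graph_def by blast
  qed
  have across: "graph_dist X (spoke a b (- x)) (spoke a c y) \<le> y - x"
    if "- 1 < x" "x \<le> 0" "0 \<le> y" "y < 1" for x y
  proof -
    have "graph_dist X (spoke a b (- x)) (spoke a c y)
        \<le> graph_dist X (spoke a b (- x)) (spoke a b 0) + graph_dist X (spoke a b 0) (spoke a c y)"
      using mem that b c by (intro triangle) auto
    also have "spoke a b 0 = spoke a c 0"
      by (simp add: spoke_def)
    finally have "graph_dist X (spoke a b (- x)) (spoke a c y)
        \<le> graph_dist X (spoke a b (- x)) (spoke a b 0) + graph_dist X (spoke a c 0) (spoke a c y)"
      by (simp add: spoke_def)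
    then show ?thesis
      using graph_dist_spoke[of a X b "- x" 0] graph_dist_spoke[of a X c 0 y] a b c that by auto
  qed
  show ?thesis
    using across[of u v] across[of v u] commute graph_dist_spoke[of a X b "- u" "- v"]
      graph_dist_spoke[of a X c u v] a b c uv
    by (cases "u < 0"; cases "v < 0") (auto simp: bent_path_def)
qed

lemma bent_path_inj:
  assumes "bent_path a b c u = bent_path a b c v" "b \<noteq> c \<or> 0 \<le> u \<and> 0 \<le> v"
  shows "u = v"
  using assms by (auto simp: bent_path_def spoke_def split: if_splits)

lemma bent_path_in_cobweb_star:
  assumes "a \<in> X" "b \<in> X - {a}" "c \<in> X - {a}"
    and "\<bar>u\<bar> < 1" "u < 0 \<Longrightarrow> - u \<le> 1 - trunc_dist d b a" "0 < u \<Longrightarrow> u \<le> 1 - trunc_dist d c a"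
  shows "bent_path a b c u \<in> cobweb_star X d a"
  using assms by (auto simp: bent_path_def spoke_def cobweb_star_eq)

lemma cobweb_star_arc:
  assumes a: "a \<in> X" and p: "p \<in> cobweb_star X d a" and q: "q \<in> cobweb_star X d a" and "p \<noteq> q"
  obtains g where "embedding_map (top_of_set {0..1::real}) (cobweb_topology X d) g"
    "g ` {0..1} \<subseteq> cobweb_star X d a" "g 0 = p" "g 1 = q"
proof -
  \<comment> \<open>Points of different edges get parameters of opposite signs; in all other cases \<open>b = c\<close> will do,
      with non-negative parameters, where the path is still injective.\<close>
  have "\<exists>b c s t. b \<in> X - {a} \<and> c \<in> X - {a} \<and> p = bent_path a b c s \<and> q = bent_path a b c t
      \<and> (b \<noteq> c \<or> 0 \<le> s \<and> 0 \<le> t)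
      \<and> (\<forall>u\<in>closed_segment s t. \<bar>u\<bar> < 1 \<and> bent_path a b c u \<in> cobweb_star X d a)"
  proof -
    have *: "\<forall>u\<in>closed_segment s t. \<bar>u\<bar> < 1 \<and> bent_path a b c u \<in> cobweb_star X d a"
      if "b \<in> X - {a}" "c \<in> X - {a}" "- 1 < s" "t < 1" "s < 1" "- 1 < t"
        "s < 0 \<or> t < 0 \<Longrightarrow> - 1 + trunc_dist d b a \<le> min s t"
        "s > 0 \<or> t > 0 \<Longrightarrow> max s t \<le> 1 - trunc_dist d c a" for b c s t
    proof (intro ballI conjI)
      fix u assume u: "u \<in> closed_segment s t"
      show "\<bar>u\<bar> < 1" using u that by (auto simp: closed_segment_eq_real_ivl split: if_splits)
      show "bent_path a b c u \<in> cobweb_star X d a"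
        by (rule bent_path_in_cobweb_star[OF a that(1,2) \<open>\<bar>u\<bar> < 1\<close>])
           (use u that in \<open>auto simp: closed_segment_eq_real_ivl split: if_splits\<close>)
    qed
    consider (1) c t where "p = Vertex a" "q = Inner a c t" "c \<in> X - {a}" "0 < t" "t < 1" "t \<le> 1 - trunc_dist d c a"
      | (2) c t where "q = Vertex a" "p = Inner a c t" "c \<in> X - {a}" "0 < t" "t < 1" "t \<le> 1 - trunc_dist d c a"
      | (3) b s c t where "p = Inner a b s" "b \<in> X - {a}" "0 < s" "s < 1" "s \<le> 1 - trunc_dist d b a"
           "q = Inner a c t" "c \<in> X - {a}" "0 < t" "t < 1" "t \<le> 1 - trunc_dist d c a"
      using p q \<open>p \<noteq> q\<close> unfolding cobweb_star_eq[OF a] by blast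
    then show ?thesis
    proof cases
      case 1
      then show ?thesis
        by (intro exI[of _ c] exI[of _ c] exI[of _ 0] exI[of _ t] conjI *)
           (auto simp: bent_path_def spoke_def)
    next
      case 2
      then show ?thesis
        by (intro exI[of _ c] exI[of _ c] exI[of _ t] exI[of _ 0] conjI *)
           (auto simp: bent_path_def spoke_def)
    next
      case 3
      show ?thesis
      proof (cases "b = c")
        case True
        with 3 show ?thesis
          by (intro exI[of _ c] exI[of _ c] exI[of _ s] exI[of _ t] conjI *)
             (auto simp: bent_path_def spoke_def)
      next
        case False
        with 3 show ?thesis
          by (intro exI[of _ b] exI[of _ c] exI[of _ "- s"] exI[of _ t] conjI *)
             (auto simp: bent_path_def spoke_def)
      qed
    qed
  qed
  then obtain b c s t where bc: "b \<in> X - {a}" "c \<in> X - {a}"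
    and ends: "p = bent_path a b c s" "q = bent_path a b c t"
    and dis: "b \<noteq> c \<or> 0 \<le> s \<and> 0 \<le> t"
    and seg: "\<And>u. u \<in> closed_segment s t \<Longrightarrow> \<bar>u\<bar> < 1 \<and> bent_path a b c u \<in> cobweb_star X d a"
    by blast
  \<comment> \<open>Reparametrize over the unit interval; \<open>s\<close> may be larger than \<open>t\<close>.\<close>
  define l where "l u = (1 - u) * s + u * t" for u
  have l: "l u \<in> closed_segment s t" if "u \<in> {0..1}" for u
    using that by (auto simp: l_def closed_segment_def)
  have l_diff: "l u - l v = (t - s) * (u - v)" for u v
    by (simp add: l_def algebra_simps)
  show ?thesis
  proof (rule that[of "\<lambda>u. bent_path a b c (l u)"])
    have sub: "(\<lambda>u. bent_path a b c (l u)) ` {0..1} \<subseteq> cobweb_star X d a"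
      using seg l by blast
    then show "(\<lambda>u. bent_path a b c (l u)) ` {0..1} \<subseteq> cobweb_star X d a" .
    have "inj_on (\<lambda>u. bent_path a b c (l u)) {0..1}"
    proof (rule inj_onI)
      fix u v :: real assume uv: "u \<in> {0..1}" "v \<in> {0..1}" "bent_path a b c (l u) = bent_path a b c (l v)"
      have "0 \<le> l w" if "w \<in> {0..1}" "0 \<le> s \<and> 0 \<le> t" for w
        using that by (auto simp: l_def)
      then have "l u = l v"
        using bent_path_inj[OF uv(3)] dis uv by blast
      then have "(t - s) * (u - v) = 0" using l_diff[of u v] by simp
      then show "u = v" using \<open>p \<noteq> q\<close> ends by auto
    qed
    moreover have "graph_dist X (bent_path a b c (l u)) (bent_path a b c (l v)) \<le> \<bar>t - s\<bar> * \<bar>u - v\<bar>"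
      if "u \<in> {0..1}" "v \<in> {0..1}" for u v
      using bent_path_Lipschitz[OF a bc, of "l u" "l v"] seg l that by (simp add: l_diff abs_mult)
    ultimately show "embedding_map (top_of_set {0..1}) (cobweb_topology X d) (\<lambda>u. bent_path a b c (l u))"
      unfolding cobweb_topology_def using sub a
      by (intro Lipschitz_injection_of_interval_imp_embedding[OF Metric_space_cobweb, where C = "\<bar>t - s\<bar>"])
         (auto simp: cobweb_def)
  qed (simp_all add: ends l_def)
qed

lemma arcwise_connectedin_cobweb_star:
  assumes "a \<in> X"
  shows "arcwise_connectedin (cobweb_topology X d) (cobweb_star X d a)"
proof -
  interpret Metric_space "cobweb X d" "graph_dist X" by (rule Metric_space_cobweb)
  show ?thesis
    unfolding arcwise_connectedin_def
  proof (intro conjI ballI impI)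
    show "cobweb_star X d a \<subseteq> topspace (cobweb_topology X d)"
      unfolding cobweb_topology_def topspace_mtopology using assms by (auto simp: cobweb_def)
  qed (use cobweb_star_arc[OF assms] in metis)
qed

section \<open>Fibers and components\<close>

lemma separablewise_component_cobweb:
  assumes "Metric_space X d" "a \<in> X" "p \<in> cobweb_star X d a"
  shows "separablewise_component (cobweb_topology X d) p = cobweb_star X d a"
proof
  interpret Metric_space "cobweb X d" "graph_dist X" by (rule Metric_space_cobweb)
  show "separablewise_component (cobweb_topology X d) p \<subseteq> cobweb_star X d a"
  proof
    fix q assume "q \<in> separablewise_component (cobweb_topology X d) p"
    then obtain S where S: "p \<in> S" "q \<in> S" "connectedin (cobweb_topology X d) S"
        "separable_space (subtopology (cobweb_topology X d) S)"
      by (auto simp: separablewise_component_def)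
    then have "q \<in> cobweb X d"
      using connectedin_subset_topspace[OF S(3)] by (auto simp: cobweb_topology_def)
    moreover have "compression X d q = a"
      using connected_separable_imp_compression_eq[OF assms(1) S(3,4) S(1,2)]
        compression_eq[OF assms(2,3)] by simp
    ultimately show "q \<in> cobweb_star X d a"
      using compression_fiber[OF assms(2)] by blast
  qed
  show "cobweb_star X d a \<subseteq> separablewise_component (cobweb_topology X d) p"
    using arcwise_connectedin_imp_subset_separablewise_component[OF arcwise_connectedin_cobweb_star]
      assms by metis
qed

theorem theorem2p8:
  fixes X :: "'a set" and d :: "'a \<Rightarrow> 'a \<Rightarrow> real"
  assumes "distance_space X d"
  shows "(\<forall>A. A \<subseteq> cobweb X d \<longrightarrow>
            |compression X d ` A| \<le>o top_density (cobweb_topology X d) A) \<and>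
         (Metric_space X d \<longrightarrow>
            compression_fibers X d =
              separablewise_component (cobweb_topology X d) ` cobweb X d \<and>
            separablewise_component (cobweb_topology X d) ` cobweb X d =
              arcwise_components (cobweb_topology X d))"
proof (intro conjI allI impI)
  let ?T = "cobweb_topology X d"
  fix A assume "A \<subseteq> cobweb X d"
  then show "|compression X d ` A| \<le>o top_density ?T A"
    by (rule card_compression_le_top_density)
next
  let ?T = "cobweb_topology X d" and ?Z = "cobweb_star X d"
  assume X: "Metric_space X d"
  have comp: "separablewise_component ?T p = ?Z a" if "a \<in> X" "p \<in> ?Z a" for a p
    using separablewise_component_cobweb[OF X that] .
  have centre: "Vertex a \<in> ?Z a" for a
    by (simp add: cobweb_star_def)
  have sep: "separablewise_component ?T ` cobweb X d = ?Z ` X"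
  proof
    show "separablewise_component ?T ` cobweb X d \<subseteq> ?Z ` X"
      using comp by (auto simp: cobweb_def)
    have "?Z a \<in> separablewise_component ?T ` cobweb X d" if "a \<in> X" for a
      using comp[OF that centre] centre[of a] that unfolding cobweb_def by (metis UN_I image_eqI)
    then show "?Z ` X \<subseteq> separablewise_component ?T ` cobweb X d" by blast
  qed
  then show "compression_fibers X d = separablewise_component ?T ` cobweb X d"
    by (simp add: compression_fibers_def compression_fiber)
  have inside: "\<exists>a\<in>X. p \<in> ?Z a \<and> S \<subseteq> ?Z a" if S: "arcwise_connectedin ?T S" "p \<in> S" for S p
  proof -
    interpret Metric_space "cobweb X d" "graph_dist X" by (rule Metric_space_cobweb)
    have "p \<in> cobweb X d"
      using S by (auto simp: arcwise_connectedin_def cobweb_topology_def)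
    then obtain a where a: "a \<in> X" "p \<in> ?Z a" by (auto simp: cobweb_def)
    then show ?thesis
      using arcwise_connectedin_imp_subset_separablewise_component[OF S] comp by metis
  qed
  have disjoint: "a = a'" if "p \<in> ?Z a" "p \<in> ?Z a'" for a a' p
    using that[THEN cobweb_star_origin] by simp
  have "arcwise_components ?T = ?Z ` X"
  proof (intro equalityI subsetI)
    fix S assume S: "S \<in> arcwise_components ?T"
    then obtain p where p: "p \<in> S" by (auto simp: arcwise_components_def)
    with S obtain a where "a \<in> X" "S \<subseteq> ?Z a"
      using inside[of S p] by (auto simp: arcwise_components_def)
    then show "S \<in> ?Z ` X"
      using S arcwise_connectedin_cobweb_star[of a X d] unfolding arcwise_components_def by blast
  next
    fix S assume "S \<in> ?Z ` X"
    then obtain a where a: "a \<in> X" "S = ?Z a" by blast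
    have "S' = ?Z a" if S': "arcwise_connectedin ?T S'" "?Z a \<subseteq> S'" for S'
    proof -
      obtain a' where "Vertex a \<in> ?Z a'" "S' \<subseteq> ?Z a'"
        using inside[OF S'(1), of "Vertex a"] S'(2) centre by blast
      then show ?thesis using S'(2) disjoint[OF centre] by blast
    qed
    then show "S \<in> arcwise_components ?T"
      using a centre[of a] arcwise_connectedin_cobweb_star[of a X d] by (auto simp: arcwise_components_def)
  qed
  with sep show "separablewise_component ?T ` cobweb X d = arcwise_components ?T" by simp
qed

end
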